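(* Suppose that for any $\theta\in\Theta$ there exists $\varepsilon_\theta>0$ such that $c_{\mathrm{stop}}(x,\theta,\gamma,i)\ge\varepsilon_\theta$ for all $i\in\mathbb{Z}_{\ge0}$, $\gamma\in(0,1]$ and $x\in\mathbb{R}^{n_x}$. Then, for any $\theta\in\Theta$ and any $\Delta>0$, there exists $i_{\mathrm{bound}}\in\mathbb{Z}_{>0}$ such that for any $\gamma\in[\gamma_\star,1]$, any $x\in\mathbb{R}^{n_x}$ with $\sigma(x)\le\Delta$ and any integer $i\ge i_{\mathrm{bound}}$, $$|V_{\gamma,i+1}(x)-V_{\gamma,i}(x)|\le c_{\mathrm{stop}}(x,\theta,\gamma,i).$$
   Context: Let $n_x,n_u\in\mathbb{Z}_{>0}$, $f:\mathbb{R}^{n_x}\times\mathbb{R}^{n_u}\to\mathbb{R}^{n_x}$, $\mathcal{U}:\mathbb{R}^{n_x}\rightrightarrows\mathbb{R}^{n_u}$ a set-valued map (admissible inputs), $\mathcal{W}:=\{(x,u):u\in\mathcal{U}(x)\}$, $\ell:\mathbb{R}^{n_x}\times\mathbb{R}^{n_u}\to\mathbb{R}_{\ge 0}$ a stage cost. For $x\in\mathbb{R}^{n_x}$ and a sequence $\mathbf{u}=(u_0,u_1,\dots)$, $\phi(k;x,\mathbf{u}|_k)$ is the state at time $k$ of $x(k+1)=f(x(k),u_k)$, $x(0)=x$; $\mathbf{u}$ is admissible from $x$ if $u_k\in\mathcal{U}(\phi(k;x,\mathbf{u}|_k))$ for all $k\in\mathbb{Z}_{\ge0}$. For $\gamma\in(0,1]$,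 $V_{\gamma,\star}(x):=\inf_{\mathbf{u}}\sum_{k=0}^\infty\gamma^k\ell(\phi(k;x,\mathbf{u}|_k),u_k)$ over admissible $\mathbf{u}$. Given $V_{\gamma,0}:\mathbb{R}^{n_x}\to\mathbb{R}_{\ge0}$, value iteration defines for $i\in\mathbb{Z}_{>0}$, $V_{\gamma,i}(x):=\inf_{u\in\mathcal{U}(x)}(\ell(x,u)+\gamma V_{\gamma,i-1}(f(x,u)))$. $\sigma:\mathbb{R}^{n_x}\to\mathbb{R}_{\ge0}$ is a given continuous, surjective function. Class $\mathcal{K}_\infty$: continuous, strictly increasing, unbounded functions $\mathbb{R}_{\ge0}\to\mathbb{R}_{\ge0}$ vanishing at $0$. Standing assumptions. (1) $f$ is continuous; each $\mathcal{U}(x)$ is non-empty and closed; $\ell$ is lower semicontinuous and there is $\alpha_\ell\in\mathcal{K}_\infty$ with $\ell(x,u)\ge\alpha_\ell(|u|)$ for all $(x,u)$; $V_{\gamma,0}$ is lower semicontinuous. (2) There exists $\underline\alpha\in\mathcal{K}_\infty$ with $\ell(x,u)\ge\underline\alpha(\sigma(x))$ for all $(x,u)\in\mathcal{W}$. (3) There exists $\overline\alpha\in\mathcal{K}_\infty$ with $V_{\gamma,i}(x)\le\overline\alpha(\sigma(x))$ and $V_{\gamma,\star}(x)\le\overline\alpha(\sigma(x))$ for all $i\in\mathbb{Z}_{\ge0}$, $\gamma\in(0,1]$, $x\in\mathbb{R}^{n_x}$. (4) There exist $\gamma_\star\in(0,1]$ and $\alpha\in\mathcal{K}_\infty$ with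 $\alpha(s)+(1-\gamma_\star)\overline\alpha(s)\le\underline\alpha(s)$ for all $s\ge0$. The stopping criterion function is $c_{\mathrm{stop}}:\mathbb{R}^{n_x}\times\Theta\times(0,1]\times\mathbb{Z}_{\ge0}\to\mathbb{R}_{\ge0}$, with parameter set $\Theta\subset\mathbb{R}^{n_\theta}$. *)

theory Defs
  imports "HOL-Analysis.Analysis"
begin

text \<open>Functions on the nonnegative reals are represented by total functions on \<^typ>\<open>real\<close>; only
  their restriction to \<open>{0..}\<close> is constrained. Nonnegativity of the values on \<open>{0..}\<close> follows
  from \<open>a 0 = 0\<close> and monotonicity.\<close>

definition class_K_inf :: "(real \<Rightarrow> real) \<Rightarrow> bool" where
  "class_K_inf a \<longleftrightarrow>
     continuous_on {0..} a \<and> strict_mono_on {0..} a \<and> a 0 = 0 \<and> (\<forall>M. \<exists>s\<ge>0. M < a s)"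

definition lower_semicont :: "('a::topological_space \<Rightarrow> real) \<Rightarrow> bool" where
  "lower_semicont g \<longleftrightarrow> (\<forall>x. ereal (g x) \<le> Liminf (at x) (\<lambda>y. ereal (g y)))"

text \<open>The state at time \<open>k\<close> takes the whole input sequence as argument but depends only on its
  first \<open>k\<close> entries \<open>us 0, \<dots>, us (k - 1)\<close>.\<close>

primrec state :: "('x \<Rightarrow> 'u \<Rightarrow> 'x) \<Rightarrow> nat \<Rightarrow> 'x \<Rightarrow> (nat \<Rightarrow> 'u) \<Rightarrow> 'x" where
  "state f 0 x us = x"
| "state f (Suc k) x us = f (state f k x us) (us k)"

definition admissible :: "('x \<Rightarrow> 'u \<Rightarrow> 'x) \<Rightarrow> ('x \<Rightarrow> 'u set) \<Rightarrow> 'x \<Rightarrow> (nat \<Rightarrow> 'u) \<Rightarrow> bool" where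
  "admissible f U x us \<longleftrightarrow> (\<forall>k. us k \<in> U (state f k x us))"

text \<open>The infinite-horizon cost is taken in \<^typ>\<open>ennreal\<close>, so that a divergent series has value
  \<open>\<infinity>\<close>; in \<^typ>\<open>real\<close> its \<^const>\<open>suminf\<close> would be unspecified.\<close>

definition opt_value ::
  "('x \<Rightarrow> 'u \<Rightarrow> 'x) \<Rightarrow> ('x \<Rightarrow> 'u set) \<Rightarrow> ('x \<Rightarrow> 'u \<Rightarrow> real) \<Rightarrow> real \<Rightarrow> 'x \<Rightarrow> ennreal" where
  "opt_value f U l \<gamma> x =
     (INF us\<in>{us. admissible f U x us}. \<Sum>k. ennreal (\<gamma> ^ k * l (state f k x us) (us k)))"

text \<open>The infimum below is the one of the conditionally complete order on \<^typ>\<open>real\<close>. It is the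
  intended one when \<open>l\<close>, \<open>V0\<close> and \<open>\<gamma>\<close> are nonnegative and every \<open>U x\<close> is nonempty, since the
  set of values is then nonempty and bounded below by \<open>0\<close>.\<close>

primrec value_iter ::
  "('x \<Rightarrow> 'u \<Rightarrow> 'x) \<Rightarrow> ('x \<Rightarrow> 'u set) \<Rightarrow> ('x \<Rightarrow> 'u \<Rightarrow> real) \<Rightarrow> real \<Rightarrow> ('x \<Rightarrow> real) \<Rightarrow> nat \<Rightarrow> 'x \<Rightarrow> real" where
  "value_iter f U l \<gamma> V0 0 = V0"
| "value_iter f U l \<gamma> V0 (Suc i) =
     (\<lambda>x. INF u\<in>U x. l x u + \<gamma> * value_iter f U l \<gamma> V0 i (f x u))"

end

theory Submission
  imports Defs
begin

text \<open>Why the iterates settle uniformly: write \<open>V i\<close> for the \<open>i\<close>-th iterate. The gap between any two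
  iterates at \<open>x\<close> is at most \<open>\<alpha>_up (\<sigma> x)\<close>, so it is at most \<open>\<epsilon>\<close> as soon as \<open>\<sigma> x\<close> is small. Where
  \<open>\<sigma> x\<close> is not small, \<open>\<alpha>_ineq\<close> together with \<open>V j x \<le> \<alpha>_up (\<sigma> x)\<close> turns the stage cost into a
  decrease: along a nearly optimal input \<open>u\<close>, the cost-to-go \<open>V (j - 1) (f x u)\<close> is below
  \<open>V j x\<close> by at least a fixed \<open>c > 0\<close>. The term \<open>(1 - \<gamma>_star) * \<alpha>_up\<close> in \<open>\<alpha>_ineq\<close> is what pays for
  the discounting. The cost-to-go being nonnegative and initially at most \<open>\<alpha>_up \<Delta>\<close>, such a
  trajectory reaches the region of small \<open>\<sigma>\<close> within \<open>\<alpha>_up \<Delta> / c\<close> steps, a number that depends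
  only on \<open>\<epsilon>\<close> and \<open>\<Delta>\<close>. Two iterates whose indices are both at least that number can
  share this initial piece of trajectory, and differ only in its tail, which costs at most
  \<open>\<epsilon>\<close> in either case.

  This argument is the induction of \<open>value_iter_gap_le\<close>, in which the number of remaining steps
  is the induction variable, so that each step of it only needs one
  nearly optimal input instead of a whole trajectory.\<close>

lemma value_iter_nonneg:
  fixes l :: "'x \<Rightarrow> 'u \<Rightarrow> real"
  assumes "\<And>x u. 0 \<le> l x u" "\<And>x. 0 \<le> V0 x" "\<And>x. U x \<noteq> {}" "0 \<le> \<gamma>"
  shows "0 \<le> value_iter f U l \<gamma> V0 i x"
  by (induction i arbitrary: x) (auto intro!: cINF_greatest simp: assms)

lemma value_iter_Suc_bdd_below:
  fixes l :: "'x \<Rightarrow> 'u \<Rightarrow> real"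
  assumes "\<And>x u. 0 \<le> l x u" "\<And>x. 0 \<le> V0 x" "\<And>x. U x \<noteq> {}" "0 \<le> \<gamma>"
  shows "bdd_below ((\<lambda>u. l x u + \<gamma> * value_iter f U l \<gamma> V0 i (f x u)) ` U x)"
  using value_iter_nonneg[of l V0 U \<gamma> f i] assms by (intro bdd_belowI2[of _ 0]) simp

text \<open>The function \<open>A\<close> is a common bound on all iterates. The hypothesis \<open>V j x < n * c\<close> limits the
  number of steps that a nearly optimal trajectory can spend in \<open>{x. s < A x}\<close> to less than \<open>n\<close>, and
  \<open>n \<le> i\<close>, \<open>n \<le> j\<close> say that neither iteration runs out before. The stage cost is required to
  exceed \<open>(1 - \<gamma>) * A x\<close> by \<open>2 * c\<close> there: one \<open>c\<close> is the guaranteed decrease, the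
  other absorbs the suboptimality of the chosen input.\<close>

lemma value_iter_gap_le:
  fixes f :: "'x \<Rightarrow> 'u \<Rightarrow> 'x" and U :: "'x \<Rightarrow> 'u set" and l :: "'x \<Rightarrow> 'u \<Rightarrow> real"
    and V0 A :: "'x \<Rightarrow> real" and \<gamma> c s :: real and n :: nat
  defines "V \<equiv> value_iter f U l \<gamma> V0"
  assumes l: "\<And>x u. 0 \<le> l x u" and V0: "\<And>x. 0 \<le> V0 x" and U: "\<And>x. U x \<noteq> {}"
    and \<gamma>: "0 < \<gamma>" "\<gamma> \<le> 1"
    and bound: "\<And>i x. V i x \<le> A x"
    and decrease: "\<And>x u. u \<in> U x \<Longrightarrow> s < A x \<Longrightarrow> 2 * c + (1 - \<gamma>) * A x \<le> l x u"
    and "0 < c" "0 \<le> s"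
    and "n \<le> i" "n \<le> j" "V j x < n * c"
  shows "V i x \<le> V j x + s"
  using \<open>n \<le> i\<close> \<open>n \<le> j\<close> \<open>V j x < n * c\<close>
proof (induction n arbitrary: i j x)
  case 0
  then show ?case
    using value_iter_nonneg[of l V0 U \<gamma> f j x] l V0 U \<gamma> by (simp add: V_def)
next
  case (Suc n)
  have nonneg: "0 \<le> V k y" for k y
    using value_iter_nonneg[of l V0 U \<gamma> f k y] l V0 U \<gamma> by (simp add: V_def)
  obtain i' j' where ij: "i = Suc i'" "j = Suc j'" "n \<le> i'" "n \<le> j'"
    using Suc.prems(1,2) by (metis Suc_le_D Suc_le_mono)
  have bdd: "bdd_below ((\<lambda>u. l x u + \<gamma> * V k (f x u)) ` U x)" for k
    using value_iter_Suc_bdd_below[of l V0 U \<gamma> x f k] l V0 U \<gamma> by (simp add: V_def)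
  have V_Suc: "V (Suc k) x = (INF u\<in>U x. l x u + \<gamma> * V k (f x u))" for k
    by (simp add: V_def)
  show ?case
  proof (cases "A x \<le> s")
    case True
    then show ?thesis
      using bound[of i x] nonneg[of j x] by linarith
  next
    case False
    show ?thesis
    proof (rule field_le_epsilon)
      fix e :: real assume "0 < e"
      define \<delta> where "\<delta> = min e c"
      have \<delta>: "0 < \<delta>" "\<delta> \<le> e" "\<delta> \<le> c"
        using \<open>0 < e\<close> \<open>0 < c\<close> by (auto simp: \<delta>_def)
      have "(INF u\<in>U x. l x u + \<gamma> * V j' (f x u)) < V j x + \<delta>"
        using V_Suc[of j'] \<delta>(1) ij by simp
      then obtain u where u: "u \<in> U x" "l x u + \<gamma> * V j' (f x u) < V j x + \<delta>"
        using cINF_less_iff[OF U bdd] by blast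
      \<comment> \<open>Dividing by \<open>\<gamma>\<close> inflates the cost-to-go; the part \<open>(1 - \<gamma>) * A x\<close> of the stage cost makes
        up for exactly this.\<close>
      have "(1 - \<gamma>) * V j x \<le> (1 - \<gamma>) * A x"
        using bound \<gamma> by (intro mult_left_mono) auto
      then have "\<gamma> * V j' (f x u) < \<gamma> * V j x - c"
        using u(2) decrease[OF u(1)] False \<delta>(3) by (simp add: algebra_simps)
      also have "\<dots> \<le> \<gamma> * (V j x - c)"
        using \<gamma> \<open>0 < c\<close> by (simp add: algebra_simps)
      finally have "V j' (f x u) < V j x - c"
        using \<gamma> by simp
      then have "V j' (f x u) < n * c"
        using Suc.prems(3) by (simp add: algebra_simps)
      then have "V i' (f x u) \<le> V j' (f x u) + s"
        using Suc.IH ij by blast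
      then have "\<gamma> * V i' (f x u) \<le> \<gamma> * V j' (f x u) + \<gamma> * s"
        using \<gamma> by (simp flip: distrib_left)
      moreover have "\<gamma> * s \<le> s"
        using \<gamma> \<open>0 \<le> s\<close> by (simp add: mult_left_le_one_le)
      moreover have "V i x \<le> l x u + \<gamma> * V i' (f x u)"
        using cINF_lower[OF bdd u(1)] V_Suc ij by simp
      ultimately show "V i x \<le> V j x + s + e"
        using u(2) \<delta>(2) by linarith
    qed
  qed
qed

lemma class_K_inf_mono:
  assumes "class_K_inf a" "0 \<le> s" "s \<le> t"
  shows "a s \<le> a t"
  using assms by (auto simp: class_K_inf_def dest!: strict_mono_on_imp_mono_on intro: mono_onD)

lemma class_K_inf_pos:
  assumes "class_K_inf a" "0 < s"
  shows "0 < a s"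
  using assms strict_mono_onD[of "{0..}" a 0 s] by (auto simp: class_K_inf_def)

lemma class_K_inf_small:
  assumes "class_K_inf a" "0 < \<epsilon>"
  obtains r where "0 < r" "a r \<le> \<epsilon>"
proof -
  have "continuous_on {0..} a" and "a 0 = 0"
    using assms(1) by (auto simp: class_K_inf_def)
  then obtain d where d: "0 < d" "\<And>t. 0 \<le> t \<Longrightarrow> dist t 0 < d \<Longrightarrow> dist (a t) 0 < \<epsilon>"
    using \<open>0 < \<epsilon>\<close> unfolding continuous_on_iff by (metis atLeast_iff order_refl)
  show thesis
    using d(1) d(2)[of "d / 2"] by (intro that[of "d / 2"]) (auto simp: dist_real_def)
qed

theorem theorem2:
  fixes f :: "real ^ 'nx::finite \<Rightarrow> real ^ 'nu::finite \<Rightarrow> real ^ 'nx"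
    and U :: "real ^ 'nx \<Rightarrow> (real ^ 'nu) set"
    and l :: "real ^ 'nx \<Rightarrow> real ^ 'nu \<Rightarrow> real"
    and V0 :: "real \<Rightarrow> real ^ 'nx \<Rightarrow> real"
    and \<sigma> :: "real ^ 'nx \<Rightarrow> real"
    and \<alpha>\<^sub>l \<alpha>_low \<alpha>_up \<alpha> :: "real \<Rightarrow> real"
    and \<gamma>_star :: real
    and \<Theta> :: "(real ^ 'nt::finite) set"
    and c_stop :: "real ^ 'nx \<Rightarrow> real ^ 'nt \<Rightarrow> real \<Rightarrow> nat \<Rightarrow> real"
  assumes l_nonneg: "\<And>x u. 0 \<le> l x u"
    and V0_nonneg: "\<And>\<gamma> x. \<gamma> \<in> {0<..1} \<Longrightarrow> 0 \<le> V0 \<gamma> x"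
    and \<sigma>_cont: "continuous_on UNIV \<sigma>"
    and \<sigma>_surj: "range \<sigma> = {0..}"
    and f_cont: "continuous_on UNIV (\<lambda>(x, u). f x u)"
    and U_nonempty: "\<And>x. U x \<noteq> {}"
    and U_closed: "\<And>x. closed (U x)"
    and l_lsc: "lower_semicont (\<lambda>(x, u). l x u)"
    and \<alpha>\<^sub>l_K: "class_K_inf \<alpha>\<^sub>l"
    and l_coercive: "\<And>x u. \<alpha>\<^sub>l (norm u) \<le> l x u"
    and V0_lsc: "\<And>\<gamma>. \<gamma> \<in> {0<..1} \<Longrightarrow> lower_semicont (V0 \<gamma>)"
    and \<alpha>_low_K: "class_K_inf \<alpha>_low"
    and l_lower: "\<And>x u. u \<in> U x \<Longrightarrow> \<alpha>_low (\<sigma> x) \<le> l x u"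
    and \<alpha>_up_K: "class_K_inf \<alpha>_up"
    and V_upper: "\<And>i \<gamma> x. \<gamma> \<in> {0<..1} \<Longrightarrow> value_iter f U l \<gamma> (V0 \<gamma>) i x \<le> \<alpha>_up (\<sigma> x)"
    and V_star_upper: "\<And>\<gamma> x. \<gamma> \<in> {0<..1} \<Longrightarrow> opt_value f U l \<gamma> x \<le> ennreal (\<alpha>_up (\<sigma> x))"
    and \<gamma>_star_range: "\<gamma>_star \<in> {0<..1}"
    and \<alpha>_K: "class_K_inf \<alpha>"
    and \<alpha>_ineq: "\<And>s. 0 \<le> s \<Longrightarrow> \<alpha> s + (1 - \<gamma>_star) * \<alpha>_up s \<le> \<alpha>_low s"
    and c_stop_nonneg: "\<And>x \<theta> \<gamma> i. \<theta> \<in> \<Theta> \<Longrightarrow> \<gamma> \<in> {0<..1} \<Longrightarrow> 0 \<le> c_stop x \<theta> \<gamma> i"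
    and c_stop_lower: "\<forall>\<theta>\<in>\<Theta>. \<exists>\<epsilon>>0. \<forall>i. \<forall>\<gamma>\<in>{0<..1}. \<forall>x. \<epsilon> \<le> c_stop x \<theta> \<gamma> i"
  shows "\<forall>\<theta>\<in>\<Theta>. \<forall>\<Delta>>0. \<exists>i_bound>0. \<forall>\<gamma>\<in>{\<gamma>_star..1}. \<forall>x. \<sigma> x \<le> \<Delta> \<longrightarrow>
    (\<forall>i\<ge>i_bound.
      \<bar>value_iter f U l \<gamma> (V0 \<gamma>) (i + 1) x - value_iter f U l \<gamma> (V0 \<gamma>) i x\<bar> \<le> c_stop x \<theta> \<gamma> i)"
proof (intro ballI allI impI)
  fix \<theta> \<Delta> assume "\<theta> \<in> \<Theta>" and "0 < (\<Delta>::real)"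
  from c_stop_lower \<open>\<theta> \<in> \<Theta>\<close> obtain \<epsilon> where "0 < \<epsilon>"
    and \<epsilon>: "\<And>i \<gamma> x. \<gamma> \<in> {0<..1} \<Longrightarrow> \<epsilon> \<le> c_stop x \<theta> \<gamma> i"
    by blast
  obtain r where r: "0 < r" "\<alpha>_up r \<le> \<epsilon>"
    using class_K_inf_small[OF \<alpha>_up_K \<open>0 < \<epsilon>\<close>] .
  \<comment> \<open>Outside \<open>{x. \<alpha>_up (\<sigma> x) \<le> \<epsilon>}\<close> one has \<open>r < \<sigma> x\<close>, hence \<open>\<alpha> (\<sigma> x)\<close> exceeds \<open>\<alpha> r = 2 * c\<close>.\<close>
  define c where "c = \<alpha> r / 2"
  have "0 < c"
    using class_K_inf_pos[OF \<alpha>_K r(1)] by (simp add: c_def)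
  obtain n :: nat where n: "\<alpha>_up \<Delta> < n * c"
    using reals_Archimedean3[OF \<open>0 < c\<close>] by blast
  have "0 < n"
    using n class_K_inf_pos[OF \<alpha>_up_K \<open>0 < \<Delta>\<close>] by (cases n) auto
  have \<sigma>_nonneg: "0 \<le> \<sigma> x" for x
    using \<sigma>_surj by auto
  have \<alpha>_up_nonneg: "0 \<le> \<alpha>_up (\<sigma> x)" for x
    using class_K_inf_mono[OF \<alpha>_up_K order_refl \<sigma>_nonneg] \<alpha>_up_K by (simp add: class_K_inf_def)
  have gap: "value_iter f U l \<gamma> (V0 \<gamma>) i x \<le> value_iter f U l \<gamma> (V0 \<gamma>) j x + \<epsilon>"
    if \<gamma>: "\<gamma> \<in> {\<gamma>_star..1}" and "\<sigma> x \<le> \<Delta>" "n \<le> i" "n \<le> j" for \<gamma> x i j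
  proof (rule value_iter_gap_le[where A = "\<lambda>x. \<alpha>_up (\<sigma> x)" and c = c and n = n])
    have \<gamma>': "\<gamma> \<in> {0<..1}"
      using \<gamma> \<gamma>_star_range by auto
    then show "0 < \<gamma>" "\<gamma> \<le> 1" "\<And>x. 0 \<le> V0 \<gamma> x"
      "\<And>i x. value_iter f U l \<gamma> (V0 \<gamma>) i x \<le> \<alpha>_up (\<sigma> x)"
      using V0_nonneg V_upper by auto
    show "2 * c + (1 - \<gamma>) * \<alpha>_up (\<sigma> y) \<le> l y u" if "u \<in> U y" "\<epsilon> < \<alpha>_up (\<sigma> y)" for y u
    proof -
      have "r \<le> \<sigma> y"
        using class_K_inf_mono[OF \<alpha>_up_K \<sigma>_nonneg, of y r] r(2) that(2) by linarith
      then have "2 * c \<le> \<alpha> (\<sigma> y)"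
        using class_K_inf_mono[OF \<alpha>_K, of r "\<sigma> y"] r(1) by (simp add: c_def)
      moreover have "(1 - \<gamma>) * \<alpha>_up (\<sigma> y) \<le> (1 - \<gamma>_star) * \<alpha>_up (\<sigma> y)"
        using \<gamma> \<alpha>_up_nonneg by (intro mult_right_mono) auto
      ultimately show ?thesis
        using \<alpha>_ineq[OF \<sigma>_nonneg, of y] l_lower[OF that(1)] by linarith
    qed
    show "value_iter f U l \<gamma> (V0 \<gamma>) j x < n * c"
      using V_upper[OF \<gamma>', of j x] class_K_inf_mono[OF \<alpha>_up_K \<sigma>_nonneg \<open>\<sigma> x \<le> \<Delta>\<close>] n by linarith
  qed (use l_nonneg U_nonempty \<open>0 < c\<close> \<open>0 < \<epsilon>\<close> that in auto)
  show "\<exists>i_bound>0. \<forall>\<gamma>\<in>{\<gamma>_star..1}. \<forall>x. \<sigma> x \<le> \<Delta> \<longrightarrow> (\<forall>i\<ge>i_bound.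
      \<bar>value_iter f U l \<gamma> (V0 \<gamma>) (i + 1) x - value_iter f U l \<gamma> (V0 \<gamma>) i x\<bar> \<le> c_stop x \<theta> \<gamma> i)"
  proof (intro exI[of _ n] conjI ballI allI impI)
    fix \<gamma> x i
    assume \<gamma>: "\<gamma> \<in> {\<gamma>_star..1}" and x: "\<sigma> x \<le> \<Delta>" and i: "n \<le> i"
    have "\<epsilon> \<le> c_stop x \<theta> \<gamma> i"
      using \<gamma> \<gamma>_star_range by (intro \<epsilon>) auto
    then show "\<bar>value_iter f U l \<gamma> (V0 \<gamma>) (i + 1) x - value_iter f U l \<gamma> (V0 \<gamma>) i x\<bar> \<le> c_stop x \<theta> \<gamma> i"
      using gap[OF \<gamma> x, of i "i + 1"] gap[OF \<gamma> x, of "i + 1" i] i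
      unfolding abs_le_iff by linarith
  qed (rule \<open>0 < n\<close>)
qed

end
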